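(* For every $\alpha\in(0,1)$, every integer $n\ge 1$ and every $x\in\mathbb{C}$ with $|x|=1$, $$A_{2n-1}(\alpha,1)\ \ge\ |A_{2n-1}(\alpha,x)|,$$ where $A_m(\alpha,x)$ denotes the coefficient of $z^m$ in the Maclaurin expansion of $\frac{(1+xz)^\alpha}{1-z}$.
   Context: For $\alpha>0$ and $x\in\mathbb{C}$ with $|x|=1$, the coefficients $A_m(\alpha,x)$ are defined by $$\frac{(1+xz)^\alpha}{1-z}=\sum_{m=0}^\infty A_m(\alpha,x)z^m,\qquad |z|<1,$$ with the principal branch of the power (value $1$ at $z=0$). Equivalently, $A_m(\alpha,x)=\sum_{k=0}^{m}\frac{\alpha(\alpha-1)\cdots(\alpha-k+1)}{k!}x^k$. *)

theory Defs
  imports "HOL-Complex_Analysis.Complex_Analysis"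
begin

text \<open>For \<open>\<bar>x\<bar> = 1\<close> and \<open>\<bar>z\<bar> < 1\<close>, the point \<open>1 + x z\<close> lies in the right half-plane,
  so \<open>powr\<close>, i.e. \<open>exp (\<alpha> * Ln (1 + x z))\<close>, is the principal branch with value \<open>1\<close>
  at \<open>z = 0\<close>.\<close>

definition A_coeff :: "nat \<Rightarrow> real \<Rightarrow> complex \<Rightarrow> complex" where
  "A_coeff m \<alpha> x =
     fps_nth (fps_expansion (\<lambda>z. (1 + x * z) powr complex_of_real \<alpha> / (1 - z)) 0) m"

lemma A_coeff_sums:
  assumes "norm x = 1" "norm z < 1"
  shows "(\<lambda>m. A_coeff m \<alpha> x * z ^ m) sums ((1 + x * z) powr complex_of_real \<alpha> / (1 - z))"
proof -
  let ?f = "\<lambda>z. (1 + x * z) powr complex_of_real \<alpha> / (1 - z)"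
  have *: "1 + x * w \<notin> \<real>\<^sub>\<le>\<^sub>0" if "norm w < 1" for w
  proof -
    have "norm (x * w) < 1" using that assms by (simp add: norm_mult)
    hence "\<bar>Re (x * w)\<bar> < 1" using abs_Re_le_cmod[of "x * w"] by linarith
    hence "Re (1 + x * w) > 0" by simp
    thus ?thesis by (auto simp: complex_nonpos_Reals_iff)
  qed
  have "?f holomorphic_on ball 0 1"
    by (intro holomorphic_intros) (use * in \<open>auto\<close>)
  from holomorphic_power_series[OF this, of z] assms(2) show ?thesis
    by (simp add: A_coeff_def fps_expansion_def)
qed

lemma A_coeff_eq_sum:
  "A_coeff m \<alpha> x = (\<Sum>k\<le>m. (complex_of_real \<alpha> gchoose k) * x ^ k)"
proof -
  let ?B = "fps_compose (fps_binomial (complex_of_real \<alpha>)) (fps_const x * fps_X)"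
  let ?G = "inverse (1 - fps_X) :: complex fps"
  have "((\<lambda>z. (1 + z) powr complex_of_real \<alpha>) \<circ> (\<lambda>z. x * z)) has_fps_expansion ?B"
    by (intro has_fps_expansion_compose fps_expansion_intros) auto
  hence "(\<lambda>z. (1 + x * z) powr complex_of_real \<alpha> * inverse (1 - z)) has_fps_expansion (?B * ?G)"
    by (intro has_fps_expansion_mult has_fps_expansion_inverse fps_expansion_intros)
       (auto simp: o_def)
  hence "fps_expansion (\<lambda>z. (1 + x * z) powr complex_of_real \<alpha> / (1 - z)) 0 = ?B * ?G"
    by (intro fps_expansion_eqI) (simp add: divide_inverse)
  moreover have "?G = Abs_fps (\<lambda>_. 1)"
    using fps_inverse_gp' [where 'a = complex]
    by (metis fps_inverse_idempotent fps_nth_Abs_fps zero_neq_one)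
  moreover have "fps_nth ?B k = (complex_of_real \<alpha> gchoose k) * x ^ k" for k
    by (simp add: fps_compose_linear)
  ultimately show ?thesis
    by (simp add: A_coeff_def fps_mult_nth atLeast0AtMost mult.commute[of "complex_of_real \<alpha> gchoose _"])
qed

lemma A_coeff_1_real: "A_coeff m \<alpha> 1 \<in> \<real>"
proof -
  have "complex_of_real \<alpha> gchoose k = of_real (\<alpha> gchoose k)" for k
    by (simp add: gbinomial_prod_rev)
  thus ?thesis by (auto simp: A_coeff_eq_sum)
qed

end

theory Submission
  imports Defs
begin

text \<open>
  Beta integrals for the binomial coefficients turn the tail of the binomial series into an
  integral: with \<open>\<kappa> = \<alpha> / Beta (1 - \<alpha>) (1 + \<alpha>)\<close>, which is at most \<open>\<alpha>\<close>,
  \<open>A\<^sub>2\<^sub>n\<^sub>-\<^sub>1(\<alpha>, x) = (1 + x)\<^sup>\<alpha> + \<kappa> x\<^sup>2\<^sup>n I(x)\<close>, where \<open>I(x)\<close> is the integral over \<open>[0, 1]\<close> of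
  \<open>w(t) / (1 + t x)\<close> with a weight \<open>w \<ge> 0\<close>.
  Now apply the triangle inequality; it is an equality at \<open>x = 1\<close>. For \<open>\<bar>x\<bar> = 1\<close> and
  \<open>v = (1 + Re x) / 2\<close> one has \<open>\<bar>1 + t x\<bar>\<^sup>2 = (1 - t)\<^sup>2 + 4 t v\<close> and \<open>\<bar>1 + x\<bar> = 2 \<surd>v\<close>, so the resulting bound
  is a function of \<open>v\<close> alone, and it is nondecreasing in \<open>v\<close>. Indeed, in the derivative put
  \<open>u = (1 - t) / (2 \<surd>(t v))\<close> and use \<open>u\<^sup>\<alpha> \<le> 1 - \<alpha> + \<alpha> u\<close>: the majorant has an elementary
  antiderivative, and its integral is exactly what \<open>\<kappa> \<le> \<alpha>\<close> needs.
\<close>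

section \<open>Beta integrals and generalized binomial coefficients\<close>

text \<open>By the reflection formula this number is sin(pi \<alpha>) / pi; the beta form fits the
  recursion of the binomial coefficients.\<close>

definition tail_const :: "real \<Rightarrow> real" where
  "tail_const \<alpha> = \<alpha> / Beta (1 - \<alpha>) (1 + \<alpha>)"

definition tail_weight :: "real \<Rightarrow> nat \<Rightarrow> real \<Rightarrow> real" where
  "tail_weight \<alpha> m t = t powr (real m - 1 - \<alpha>) * (1 - t) powr \<alpha>"

definition tail_integral :: "real \<Rightarrow> nat \<Rightarrow> complex \<Rightarrow> complex" where
  "tail_integral \<alpha> m x = integral {0..1} (\<lambda>t. of_real (tail_weight \<alpha> m t) / (1 + of_real t * x))"

lemma tail_weight_nonneg [simp]: "tail_weight \<alpha> m t \<ge> 0"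
  by (simp add: tail_weight_def)

text \<open>From m = 2 on, the exponent m - 1 - \<alpha> of t is positive, so there is no
  singularity at t = 0, where \<open>powr\<close> gives the value 0.\<close>

lemma continuous_on_tail_weight:
  assumes "0 < \<alpha>" "\<alpha> < 1" "m \<ge> 2"
  shows "continuous_on {0..1} (tail_weight \<alpha> m)"
  unfolding tail_weight_def using assms
  by (intro continuous_on_mult continuous_on_powr' continuous_intros) auto

lemma has_integral_tail_weight:
  assumes "0 < \<alpha>" "\<alpha> < 1" "m \<ge> 1"
  shows "(tail_weight \<alpha> m has_integral Beta (real m - \<alpha>) (1 + \<alpha>)) {0..1}"
  using has_integral_Beta_real[of "real m - \<alpha>" "1 + \<alpha>"] assms
  unfolding tail_weight_def by (simp add: algebra_simps)

lemma Beta_pos: "0 < a \<Longrightarrow> 0 < b \<Longrightarrow> 0 < Beta a (b :: real)"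
  by (simp add: Beta_def)

lemma tail_const_pos:
  assumes "0 < \<alpha>" "\<alpha> < 1"
  shows "0 < tail_const \<alpha>"
  using assms Beta_pos[of "1 - \<alpha>" "1 + \<alpha>"] by (simp add: tail_const_def)

text \<open>The midpoint of 1 - \<alpha> and 1 + \<alpha> is 1, so log-convexity gives Gamma(1 -
  \<alpha>) Gamma(1 + \<alpha>) >= Gamma(1)^2 = 1. The denominator of the beta function is Gamma(2)
  = 1.\<close>

lemma tail_const_le:
  assumes "0 < \<alpha>" "\<alpha> < 1"
  shows "tail_const \<alpha> \<le> \<alpha>"
proof -
  have "(ln \<circ> Gamma) ((1 - 1/2) *\<^sub>R (1 - \<alpha>) + (1/2) *\<^sub>R (1 + \<alpha>))
      \<le> (1 - 1/2) * (ln \<circ> Gamma) (1 - \<alpha>) + (1/2) * (ln \<circ> Gamma) (1 + \<alpha>)"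
    by (rule convex_onD[OF log_convex_Gamma_real]) (use assms in auto)
  hence "ln (Gamma (1 - \<alpha>) * Gamma (1 + \<alpha>)) \<ge> 0"
    using assms by (simp add: ln_mult Gamma_real_pos less_imp_neq[symmetric] field_simps)
  hence "Beta (1 - \<alpha>) (1 + \<alpha>) \<ge> 1"
    using assms Gamma_real_pos[of "1 - \<alpha>"] Gamma_real_pos[of "1 + \<alpha>"]
    by (simp add: Beta_def Gamma_numeral)
  thus ?thesis
    using assms by (simp add: tail_const_def divide_le_eq)
qed

text \<open>Both sides satisfy (k + 1) c(k + 1) = (\<alpha> - k) c(k), and \<open>tail_const\<close>
  is the normalisation that makes them agree at m = 1.\<close>

lemma gbinomial_conv_Beta:
  fixes \<alpha> :: real
  assumes "0 < \<alpha>" "\<alpha> < 1" "m \<ge> 1"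
  shows "\<alpha> gchoose m = - ((-1) ^ m * tail_const \<alpha> * Beta (real m - \<alpha>) (1 + \<alpha>))"
  using \<open>m \<ge> 1\<close>
proof (induction m rule: dec_induct)
  case base
  have "Beta (1 - \<alpha>) (1 + \<alpha>) \<noteq> 0"
    using Beta_pos[of "1 - \<alpha>" "1 + \<alpha>"] assms by simp
  thus ?case by (simp add: tail_const_def)
next
  case (step k)
  have B: "Beta (real (Suc k) - \<alpha>) (1 + \<alpha>) * real (Suc k) = (real k - \<alpha>) * Beta (real k - \<alpha>) (1 + \<alpha>)"
  proof -
    have "real k - \<alpha> \<notin> \<int>\<^sub>\<le>\<^sub>0"
      using step assms by (auto elim!: nonpos_Ints_cases')
    from Beta_plus1_left[OF this, of "1 + \<alpha>"] show ?thesis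
      by (simp add: algebra_simps)
  qed
  have "real (Suc k) * (\<alpha> gchoose Suc k) = (\<alpha> - real k) * (\<alpha> gchoose k)"
    using gbinomial_mult_1[of \<alpha> k] by (simp add: algebra_simps)
  also have "\<dots> = (-1) ^ k * tail_const \<alpha> * ((real k - \<alpha>) * Beta (real k - \<alpha>) (1 + \<alpha>))"
    unfolding step.IH by (simp add: algebra_simps)
  also have "\<dots> = real (Suc k) * - ((-1) ^ Suc k * tail_const \<alpha> * Beta (real (Suc k) - \<alpha>) (1 + \<alpha>))"
    unfolding B[symmetric] by (simp add: algebra_simps)
  finally show ?case by (simp del: of_nat_Suc)
qed

lemma of_real_gbinomial: "complex_of_real \<alpha> gchoose k = of_real (\<alpha> gchoose k)"
  by (simp add: gbinomial_prod_rev)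

section \<open>Integral remainder of the binomial series\<close>

lemma one_plus_tx_nz:
  fixes x :: complex
  assumes "norm x \<le> 1" "x \<noteq> -1" "t \<in> {0..1::real}"
  shows "1 + of_real t * x \<noteq> (0::complex)"
proof
  assume eq: "1 + of_real t * x = 0"
  hence "of_real t * x = -1" by (simp add: add_eq_0_iff)
  hence "t * norm x = 1" using assms(3)
    by (metis abs_of_nonneg atLeastAtMost_iff norm_minus_cancel norm_mult norm_of_real norm_one)
  moreover have "t * norm x \<le> t" using assms by (simp add: mult_left_le)
  ultimately have "t = 1" using assms(3) by auto
  with eq have "x = -1" by (simp add: add_eq_0_iff)
  with assms show False by simp
qed

lemma continuous_on_tail_integrand:
  fixes x :: complex
  assumes "0 < \<alpha>" "\<alpha> < 1" "m \<ge> 2" "norm x \<le> 1" "x \<noteq> -1"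
  shows "continuous_on {0..1} (\<lambda>t. of_real (tail_weight \<alpha> m t) / (1 + of_real t * x))"
  using assms one_plus_tx_nz
  by (intro continuous_intros continuous_on_tail_weight) auto

text \<open>Raising m by one multiplies the weight by t, so the two integrands combine to the weight
  times (1 + t x) / (1 + t x). With the beta formula for the coefficients, this makes the remainder
  telescope.\<close>

lemma tail_integral_rec:
  fixes x :: complex
  assumes "0 < \<alpha>" "\<alpha> < 1" "m \<ge> 2" "norm x \<le> 1" "x \<noteq> -1"
  shows "tail_integral \<alpha> m x + x * tail_integral \<alpha> (Suc m) x = of_real (Beta (real m - \<alpha>) (1 + \<alpha>))"
proof -
  let ?f = "\<lambda>m t. of_real (tail_weight \<alpha> m t) / (1 + of_real t * x)"
  have int: "?f k integrable_on {0..1}" if "k \<ge> 2" for k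
    using continuous_on_tail_integrand[of \<alpha> k x] assms that
    by (intro integrable_continuous_interval) auto
  have "tail_integral \<alpha> m x + x * tail_integral \<alpha> (Suc m) x
      = integral {0..1} (\<lambda>t. ?f m t + x * ?f (Suc m) t)"
    using integral_add[OF int[of m] integrable_on_mult_right[OF int[of "Suc m"], of x]] assms
    unfolding tail_integral_def by (simp only: integral_mult_right)
  also have "\<dots> = integral {0..1} (\<lambda>t. complex_of_real (tail_weight \<alpha> m t))"
  proof (rule integral_cong)
    fix t :: real assume t: "t \<in> {0..1}"
    have "tail_weight \<alpha> (Suc m) t = t * tail_weight \<alpha> m t"
      using t assms by (cases "t = 0") (auto simp: tail_weight_def powr_diff powr_add)
    thus "?f m t + x * ?f (Suc m) t = of_real (tail_weight \<alpha> m t)"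
      using one_plus_tx_nz[OF assms(4,5) t] by (simp add: divide_simps) (simp add: algebra_simps)
  qed
  also have "\<dots> = of_real (Beta (real m - \<alpha>) (1 + \<alpha>))"
    using has_integral_tail_weight[of \<alpha> m] assms
    by (intro integral_unique has_integral_of_real) auto
  finally show ?thesis .
qed

text \<open>A crude bound that is uniform in m: inside the disc the factor x^m then forces the
  remainder to 0.\<close>

lemma tail_integral_bound:
  fixes x :: complex
  assumes "0 < \<alpha>" "\<alpha> < 1" "m \<ge> 2" "norm x < 1"
  shows "norm (tail_integral \<alpha> m x) \<le> 1 / (1 - norm x)"
proof -
  have nx: "x \<noteq> -1" using assms by auto
  have "norm (tail_integral \<alpha> m x) \<le> 1 / (1 - norm x) * (1 - 0)"
    unfolding tail_integral_def
  proof (rule integral_bound)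
    fix t :: real assume t: "t \<in> {0..1}"
    have "t * norm x \<le> norm x" using t by (simp add: mult_left_le_one_le)
    moreover have "norm (1 :: complex) - norm (of_real t * x) \<le> norm (1 + of_real t * x)"
      by (rule norm_diff_ineq)
    ultimately have n: "norm (1 + of_real t * x) \<ge> 1 - norm x"
      using t by (simp add: norm_mult)
    have "t powr (real m - 1 - \<alpha>) \<le> 1" "(1 - t) powr \<alpha> \<le> 1"
      using t assms by (auto intro!: powr_le1)
    hence "tail_weight \<alpha> m t \<le> 1"
      unfolding tail_weight_def by (simp add: mult_le_one)
    thus "norm (of_real (tail_weight \<alpha> m t) / (1 + of_real t * x)) \<le> 1 / (1 - norm x)"
      using n assms by (simp add: norm_divide frac_le)
  qed (use continuous_on_tail_integrand[of \<alpha> m x] assms nx in auto)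
  thus ?thesis by simp
qed

text \<open>By \<open>tail_integral_rec\<close>, partial sum minus remainder is the same for all
  indices from 2 on; its limit is the full binomial series.\<close>

lemma binomial_partial_sum_interior:
  fixes x :: complex
  assumes "0 < \<alpha>" "\<alpha> < 1" "m \<ge> 2" "norm x < 1"
  shows "(\<Sum>k<m. (complex_of_real \<alpha> gchoose k) * x ^ k)
       = (1 + x) powr \<alpha> + tail_const \<alpha> * (- x) ^ m * tail_integral \<alpha> m x"
proof -
  have nx: "x \<noteq> -1" using assms by auto
  define T where "T m = (\<Sum>k<m. (complex_of_real \<alpha> gchoose k) * x ^ k)" for m
  define R where "R m = tail_const \<alpha> * (- x) ^ m * tail_integral \<alpha> m x" for m
  have rec: "T (Suc k) - R (Suc k) = T k - R k" if "k \<ge> 2" for k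
  proof -
    have "T (Suc k) - R (Suc k) - (T k - R k) = (complex_of_real \<alpha> gchoose k) * x ^ k
       + tail_const \<alpha> * (- x) ^ k * (tail_integral \<alpha> k x + x * tail_integral \<alpha> (Suc k) x)"
      by (simp add: T_def R_def algebra_simps)
    also have "\<dots> = 0"
      using that assms nx
      by (simp add: tail_integral_rec of_real_gbinomial gbinomial_conv_Beta power_minus[of x])
    finally show ?thesis by simp
  qed
  have const: "T k - R k = T m - R m" if "k \<ge> m" for k
    using that
  proof (induction k rule: dec_induct)
    case (step i)
    thus ?case using \<open>m \<ge> 2\<close> by (simp only: rec)
  qed simp
  have "T \<longlonglongrightarrow> (1 + x) powr \<alpha>"
    using gen_binomial_complex[of x "of_real \<alpha>"] assms by (simp add: sums_def T_def[abs_def])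
  moreover have "R \<longlonglongrightarrow> 0"
  proof (rule Lim_null_comparison)
    show "\<forall>\<^sub>F k in sequentially. norm (R k) \<le> (tail_const \<alpha> / (1 - norm x)) * norm x ^ k"
      using eventually_ge_at_top[of 2]
    proof eventually_elim
      case (elim k)
      have "norm (R k) = tail_const \<alpha> * norm x ^ k * norm (tail_integral \<alpha> k x)"
        using tail_const_pos[of \<alpha>] assms by (simp add: R_def norm_mult norm_power)
      also have "\<dots> \<le> tail_const \<alpha> * norm x ^ k * (1 / (1 - norm x))"
        using tail_const_pos[of \<alpha>] assms elim
        by (intro mult_left_mono tail_integral_bound) auto
      finally show ?case by simp
    qed
    show "(\<lambda>k. (tail_const \<alpha> / (1 - norm x)) * norm x ^ k) \<longlonglongrightarrow> 0"
      using assms by (intro tendsto_mult_right_zero LIMSEQ_power_zero) auto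
  qed
  ultimately have "(\<lambda>k. T k - R k) \<longlonglongrightarrow> (1 + x) powr \<alpha> - 0"
    by (rule tendsto_diff)
  moreover have "(\<lambda>k. T k - R k) \<longlonglongrightarrow> T m - R m"
    using const by (intro tendsto_eventually eventually_sequentiallyI[of m])
  ultimately have "(1 + x) powr \<alpha> - 0 = T m - R m"
    by (rule LIMSEQ_unique)
  thus ?thesis by (simp add: T_def R_def algebra_simps)
qed

lemma continuous_on_tail_integral:
  assumes "0 < \<alpha>" "\<alpha> < 1" "m \<ge> 2"
  shows "continuous_on {x :: complex. norm x \<le> 1 \<and> x \<noteq> -1} (tail_integral \<alpha> m)"
proof -
  have "continuous_on ({x :: complex. norm x \<le> 1 \<and> x \<noteq> -1} \<times> cbox 0 1)
    (\<lambda>(x, t). complex_of_real (tail_weight \<alpha> m t) / (1 + of_real t * x))"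
    unfolding case_prod_beta using one_plus_tx_nz
    by (intro continuous_intros continuous_on_compose2[OF continuous_on_tail_weight[OF assms]]) auto
  from integral_continuous_on_param[OF this] show ?thesis
    by (simp add: tail_integral_def[abs_def])
qed

text \<open>Radial passage to the circle: both sides are continuous along r x for r in [0, 1] and
  agree for r < 1.\<close>

lemma binomial_partial_sum:
  fixes x :: complex
  assumes "0 < \<alpha>" "\<alpha> < 1" "m \<ge> 2" "norm x \<le> 1" "x \<noteq> -1"
  shows "(\<Sum>k<m. (complex_of_real \<alpha> gchoose k) * x ^ k)
       = (1 + x) powr \<alpha> + tail_const \<alpha> * (- x) ^ m * tail_integral \<alpha> m x"
proof -
  define g where "g y = (\<Sum>k<m. (complex_of_real \<alpha> gchoose k) * y ^ k)
    - ((1 + y) powr \<alpha> + tail_const \<alpha> * (- y) ^ m * tail_integral \<alpha> m y)" for y :: complex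
  have nr: "norm (of_real r * x) \<le> 1 \<and> of_real r * x \<noteq> -1" if "r \<in> {0..1}" for r :: real
    using that one_plus_tx_nz[OF assms(4,5) that] assms
    by (auto simp: norm_mult mult_le_one)
  \<comment> \<open>A nonnegative real part keeps 1 + r x off the branch cut, so the principal power
    is continuous along the radius.\<close>
  have nn: "0 \<le> 1 + r * Re x" if "r \<in> {0..1}" for r :: real
  proof -
    have "\<bar>Re (of_real r * x)\<bar> \<le> 1"
      using abs_Re_le_cmod[of "of_real r * x"] nr[OF that] by linarith
    thus ?thesis by simp
  qed
  have cont: "continuous_on (closure {0..<1}) (\<lambda>r. g (of_real r * x))"
  proof -
    have "continuous_on {0..1} (\<lambda>r. tail_integral \<alpha> m (of_real r * x))"
      by (rule continuous_on_compose2[OF continuous_on_tail_integral[OF assms(1-3)]])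
         (use nr in \<open>auto intro!: continuous_intros\<close>)
    moreover have "continuous_on {0..1} (\<lambda>r. (1 + of_real r * x) powr complex_of_real \<alpha>)"
      using nn assms(1) by (intro continuous_intros) auto
    ultimately show ?thesis
      unfolding g_def by (simp add: continuous_intros)
  qed
  have "g (of_real 1 * x) = 0"
  proof (rule continuous_constant_on_closure[OF cont])
    fix r :: real assume r: "r \<in> {0..<1}"
    have "norm (of_real r * x) \<le> r" using r assms by (simp add: norm_mult mult_left_le)
    hence "norm (of_real r * x) < 1" using r by simp
    with assms show "g (of_real r * x) = 0"
      by (simp add: g_def binomial_partial_sum_interior)
  qed auto
  thus ?thesis by (simp add: g_def)
qed


section \<open>The tail bound as a function of v, and its derivative\<close>

text \<open>For x = e^(i \<theta>) and v = cos^2(\<theta> / 2) this is the squared norm of 1 + t x.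
  It is affine in v.\<close>

definition kern :: "real \<Rightarrow> real \<Rightarrow> real" where
  "kern v t = (1 - t)\<^sup>2 + 4 * t * v"

lemma kern_pos:
  assumes "0 < v" "t \<in> {0..1}"
  shows "0 < kern v t"
proof (cases "t = 0")
  case False
  thus ?thesis using assms unfolding kern_def by (intro add_nonneg_pos) auto
qed (simp add: kern_def)

lemma norm_one_plus_tx:
  fixes x :: complex
  assumes "norm x = 1"
  shows "norm (1 + of_real t * x) = sqrt (kern ((1 + Re x) / 2) t)"
proof -
  have "(Re x)\<^sup>2 + (Im x)\<^sup>2 = 1"
    using assms by (simp add: cmod_def)
  hence "(1 + t * Re x)\<^sup>2 + (t * Im x)\<^sup>2 = kern ((1 + Re x) / 2) t"
    unfolding kern_def by algebra
  thus ?thesis by (simp add: cmod_def)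
qed

definition abs_tail :: "real \<Rightarrow> nat \<Rightarrow> real \<Rightarrow> real" where
  "abs_tail \<alpha> m v = integral {0..1} (\<lambda>t. tail_weight \<alpha> m t / sqrt (kern v t))"

text \<open>Minus the derivative in v, since kern^(-1/2) has derivative -2 t kern^(-3/2); with this
  sign the integrand is nonnegative for v > 0.\<close>

definition abs_tail_deriv :: "real \<Rightarrow> nat \<Rightarrow> real \<Rightarrow> real" where
  "abs_tail_deriv \<alpha> m v = integral {0..1} (\<lambda>t. 2 * t * tail_weight \<alpha> m t / (kern v t * sqrt (kern v t)))"

lemma continuous_on_kern: "continuous_on S (kern v)"
  unfolding kern_def by (intro continuous_intros)

lemma integrable_abs_tail:
  assumes "0 < \<alpha>" "\<alpha> < 1" "m \<ge> 2" "0 < v"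
  shows "(\<lambda>t. tail_weight \<alpha> m t / sqrt (kern v t)) integrable_on {0..1}"
  using assms kern_pos[of v]
  by (intro integrable_continuous_interval continuous_intros continuous_on_tail_weight continuous_on_kern)
     (auto simp: less_imp_neq[symmetric])

lemma has_real_derivative_abs_tail:
  assumes "0 < \<alpha>" "\<alpha> < 1" "m \<ge> 2" "0 < v"
  shows "(abs_tail \<alpha> m has_real_derivative - abs_tail_deriv \<alpha> m v) (at v)"
proof -
  have "((\<lambda>v. integral (cbox 0 1) (\<lambda>t. tail_weight \<alpha> m t / sqrt (kern v t))) has_field_derivative
     integral (cbox 0 1) (\<lambda>t. - (2 * t * tail_weight \<alpha> m t / (kern v t * sqrt (kern v t))))) (at v within {0<..})"
  proof (rule leibniz_rule_field_derivative)
    fix v t :: real assume v: "v \<in> {0<..}" and t: "t \<in> cbox 0 1"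
    have D: "0 < kern v t" using kern_pos v t by auto
    have "((\<lambda>v. kern v t) has_field_derivative 4 * t) (at v within {0<..})"
      unfolding kern_def by (auto intro!: derivative_eq_intros)
    thus "((\<lambda>v. tail_weight \<alpha> m t / sqrt (kern v t)) has_field_derivative
       - (2 * t * tail_weight \<alpha> m t / (kern v t * sqrt (kern v t)))) (at v within {0<..})"
      using D by (auto intro!: derivative_eq_intros simp: divide_simps)
  next
    have "continuous_on ({0<..} \<times> cbox 0 1) (\<lambda>p. kern (fst p) (snd p))"
      unfolding kern_def by (intro continuous_intros)
    thus "continuous_on ({0<..} \<times> cbox 0 1)
        (\<lambda>(v, t). - (2 * t * tail_weight \<alpha> m t / (kern v t * sqrt (kern v t))))"
      unfolding case_prod_beta using kern_pos
      by (intro continuous_intros continuous_on_compose2[OF continuous_on_tail_weight[OF assms(1-3)]])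
         (auto simp: less_imp_neq[symmetric])
  qed (use assms integrable_abs_tail in auto)
  thus ?thesis using assms
    by (simp add: at_within_open[of _ "{0<..}"] abs_tail_def[abs_def] abs_tail_deriv_def)
qed

section \<open>Closed-form majorant and monotonicity in v\<close>

text \<open>The antiderivative is \<alpha> / (2 v) at t = 1 and -(1 - \<alpha>) / (2 v) at t = 0, so
  \<alpha> drops out of the integral.\<close>

lemma has_integral_majorant:
  assumes "0 < v"
  shows "((\<lambda>t. (1 + t) * (1 - \<alpha> + \<alpha> * ((1 - t) / (2 * sqrt (t * v)))) / (kern v t * sqrt (kern v t)))
      has_integral 1 / (2 * v)) {0..1}"
proof -
  \<comment> \<open>The integrand is affine in \<alpha>, and so is \<open>H\<close>: for \<alpha> =
    0 the antiderivative is -(1 - t) / (2 v sqrt(kern)), for \<alpha> = 1 it is sqrt(t v) / (v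
    sqrt(kern)).\<close>
  define H where "H t = ((2 * \<alpha> * sqrt (t * v) - (1 - \<alpha>) * (1 - t)) / sqrt (kern v t)) / (2 * v)" for t
  have "((\<lambda>t. (1 + t) * (1 - \<alpha> + \<alpha> * ((1 - t) / (2 * sqrt (t * v)))) / (kern v t * sqrt (kern v t)))
      has_integral (H 1 - H 0)) {0..1}"
  \<comment> \<open>The square root of t v is not differentiable at t = 0, so derivatives are taken
    in the open interval only.\<close>
  proof (rule fundamental_theorem_of_calculus_interior)
    show "continuous_on {0..1} H"
      unfolding H_def using assms kern_pos[OF assms]
      by (intro continuous_intros continuous_on_kern) (auto simp: less_imp_neq[symmetric])
    fix t :: real assume t: "t \<in> {0<..<1}"
    define D where "D = kern v t"
    define s where "s = sqrt (t * v)"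
    have D: "0 < D" using kern_pos[OF assms, of t] t by (simp add: D_def)
    have s: "0 < s" "s\<^sup>2 = t * v" using assms t by (simp_all add: s_def)
    have dk: "(kern v has_real_derivative (4 * v - 2 * (1 - t))) (at t)"
      unfolding kern_def[abs_def] by (auto intro!: derivative_eq_intros)
    have ds: "((\<lambda>t. sqrt (t * v)) has_real_derivative v / (2 * s)) (at t)"
      using assms t by (auto intro!: derivative_eq_intros simp: s_def inverse_eq_divide mult_less_0_iff)
    have dl: "((\<lambda>t. (1 - \<alpha>) * (1 - t)) has_real_derivative - (1 - \<alpha>)) (at t)"
      by (auto intro!: derivative_eq_intros)
    have dsk: "((\<lambda>t. sqrt (kern v t)) has_real_derivative (4 * v - 2 * (1 - t)) / (2 * sqrt D)) (at t)"
      using D dk by (auto intro!: derivative_eq_intros simp: D_def field_simps)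
    have "(H has_real_derivative
       (((2 * \<alpha> * (v / (2 * s)) + (1 - \<alpha>)) * sqrt D
         - (2 * \<alpha> * s - (1 - \<alpha>) * (1 - t)) * ((4 * v - 2 * (1 - t)) / (2 * sqrt D)))
         / (sqrt D * sqrt D)) / (2 * v)) (at t)" (is "(H has_real_derivative ?d) _")
      unfolding H_def
      by (rule DERIV_cong[OF DERIV_cdivide[OF DERIV_divide[OF DERIV_diff[OF DERIV_cmult[OF ds] dl] dsk]]])
         (use D in \<open>auto simp: D_def s_def\<close>)
    also have "?d = (1 + t) * (1 - \<alpha> + \<alpha> * ((1 - t) / (2 * s))) / (D * sqrt D)"
    proof -
      define r where "r = sqrt D"
      have r: "0 < r" "D = r * r" using D by (simp_all add: r_def)
      have e: "r\<^sup>2 = (1 - t)\<^sup>2 + 4 * t * v"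
        using r by (simp add: power2_eq_square D_def kern_def)
      have "?d = ((2 * \<alpha> * v / (2 * s) + (1 - \<alpha>)) * r\<^sup>2
         - (2 * \<alpha> * s - (1 - \<alpha>) * (1 - t)) * (2 * v - (1 - t))) / (2 * v * r ^ 3)"
        unfolding r_def[symmetric] using r assms s
        by (simp add: divide_simps) (simp add: algebra_simps power2_eq_square power3_eq_cube)
      also have "(2 * \<alpha> * v / (2 * s) + (1 - \<alpha>)) * r\<^sup>2
         - (2 * \<alpha> * s - (1 - \<alpha>) * (1 - t)) * (2 * v - (1 - t))
         = 2 * v * ((1 + t) * (1 - \<alpha> + \<alpha> * ((1 - t) / (2 * s))))"
      proof -
        \<comment> \<open>Multiplying by s clears 1 / s; after substituting s^2 = t v and the value
          of r^2, the claim is a polynomial identity.\<close>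
        have "s * ((2 * \<alpha> * v / (2 * s) + (1 - \<alpha>)) * r\<^sup>2
           - (2 * \<alpha> * s - (1 - \<alpha>) * (1 - t)) * (2 * v - (1 - t)))
           = (\<alpha> * v + (1 - \<alpha>) * s) * r\<^sup>2 - (2 * \<alpha> * s\<^sup>2 - (1 - \<alpha>) * (1 - t) * s) * (2 * v - (1 - t))"
          using s(1) by (simp add: field_simps power2_eq_square)
        also have "\<dots> = v * ((1 + t) * (2 * (1 - \<alpha>) * s + \<alpha> * (1 - t)))"
          unfolding e s(2) by algebra
        also have "\<dots> = s * (2 * v * ((1 + t) * (1 - \<alpha> + \<alpha> * ((1 - t) / (2 * s)))))"
          using s(1) by (simp add: field_simps)
        finally show ?thesis using s(1) by simp
      qed
      finally show ?thesis
        using assms r by (simp add: r_def[symmetric] power3_eq_cube mult.assoc)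
    qed
    finally show "(H has_vector_derivative
        (1 + t) * (1 - \<alpha> + \<alpha> * ((1 - t) / (2 * sqrt (t * v)))) / (kern v t * sqrt (kern v t))) (at t)"
      by (simp add: has_real_derivative_iff_has_vector_derivative D_def s_def)
  qed simp
  moreover have "H 1 - H 0 = 1 / (2 * v)"
    using assms by (simp add: H_def kern_def real_sqrt_mult field_simps)
  ultimately show ?thesis by simp
qed

text \<open>With 1 - t = 2 sqrt(v) sqrt(t) w, Young's inequality bounds w^\<alpha>, and the
  remaining power of t is at most t, hence at most (1 + t) / 2.\<close>

lemma tail_weight_le:
  assumes "0 < \<alpha>" "\<alpha> < 1" "m \<ge> 2" "0 < v" "t \<in> {0..1}"
  shows "2 * t * tail_weight \<alpha> m t
      \<le> (2 * sqrt v) powr \<alpha> * ((1 + t) * (1 - \<alpha> + \<alpha> * ((1 - t) / (2 * sqrt (t * v)))))"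
proof (cases "t = 0 \<or> t = 1")
  \<comment> \<open>At both endpoints the left side vanishes; at t = 0 the quotient on the right is
    0 by the convention for division by 0.\<close>
  case True
  thus ?thesis using assms by (auto simp: tail_weight_def)
next
  case False
  with assms have t: "0 < t" "t < 1" by auto
  define w where "w = (1 - t) / (2 * sqrt (t * v))"
  have w: "0 < w" using t assms by (simp add: w_def)
  have young: "w powr \<alpha> \<le> 1 - \<alpha> + \<alpha> * w"
    using Youngs_inequality_0[of \<alpha> "1 - \<alpha>" w 1] assms w by simp
  have "1 - t = (2 * sqrt v) * sqrt t * w"
    using t assms by (simp add: w_def real_sqrt_mult)
  hence eq: "(1 - t) powr \<alpha> = (2 * sqrt v) powr \<alpha> * t powr (\<alpha> / 2) * w powr \<alpha>"
    using t w assms by (simp add: powr_mult powr_half_sqrt[symmetric] powr_powr)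
  have "t * t powr (real m - 1 - \<alpha>) * t powr (\<alpha> / 2) = t powr (real m - \<alpha> / 2)"
    using t by (simp add: powr_mult_base flip: powr_add)
  also have "\<dots> \<le> t powr 1"
    using t assms by (intro powr_mono') auto
  also have "t powr 1 = t"
    using t by simp
  finally have tp: "2 * (t * t powr (real m - 1 - \<alpha>) * t powr (\<alpha> / 2)) \<le> 1 + t"
    using t by linarith
  have "2 * t * tail_weight \<alpha> m t
      = (2 * sqrt v) powr \<alpha> * ((2 * (t * t powr (real m - 1 - \<alpha>) * t powr (\<alpha> / 2))) * w powr \<alpha>)"
    unfolding tail_weight_def eq by (simp add: mult_ac)
  also have "\<dots> \<le> (2 * sqrt v) powr \<alpha> * ((1 + t) * (1 - \<alpha> + \<alpha> * w))"
    using t tp young by (intro mult_left_mono mult_mono) auto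
  finally show ?thesis by (simp add: w_def)
qed

lemma abs_tail_deriv_le:
  assumes "0 < \<alpha>" "\<alpha> < 1" "m \<ge> 2" "0 < v"
  shows "abs_tail_deriv \<alpha> m v \<le> (2 * sqrt v) powr \<alpha> / (2 * v)"
proof -
  let ?f = "\<lambda>t. 2 * t * tail_weight \<alpha> m t / (kern v t * sqrt (kern v t))"
  have "?f integrable_on {0..1}"
    using assms kern_pos[of v]
    by (intro integrable_continuous_interval continuous_intros continuous_on_tail_weight continuous_on_kern)
       (auto simp: less_imp_neq[symmetric])
  hence "(?f has_integral abs_tail_deriv \<alpha> m v) {0..1}"
    by (simp add: abs_tail_deriv_def integrable_integral)
  moreover have "((\<lambda>t. (2 * sqrt v) powr \<alpha> *
      ((1 + t) * (1 - \<alpha> + \<alpha> * ((1 - t) / (2 * sqrt (t * v)))) / (kern v t * sqrt (kern v t))))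
      has_integral (2 * sqrt v) powr \<alpha> * (1 / (2 * v))) {0..1}"
    by (intro has_integral_mult_right has_integral_majorant assms)
  ultimately have "abs_tail_deriv \<alpha> m v \<le> (2 * sqrt v) powr \<alpha> * (1 / (2 * v))"
  proof (rule has_integral_le)
    fix t :: real assume t: "t \<in> {0..1}"
    have "0 < kern v t * sqrt (kern v t)" using kern_pos[OF assms(4) t] by simp
    thus "?f t \<le> (2 * sqrt v) powr \<alpha> *
      ((1 + t) * (1 - \<alpha> + \<alpha> * ((1 - t) / (2 * sqrt (t * v)))) / (kern v t * sqrt (kern v t)))"
      using divide_right_mono[OF tail_weight_le[OF assms t], of "kern v t * sqrt (kern v t)"] by simp
  qed
  thus ?thesis by simp
qed

text \<open>The first term has derivative \<alpha> q with q = (2 sqrt v)^\<alpha> / (2 v), and q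
  also bounds \<open>abs_tail_deriv\<close>, so \<open>tail_const_le\<close> decides the
  sign.\<close>

lemma powr_plus_abs_tail_le:
  assumes "0 < \<alpha>" "\<alpha> < 1" "m \<ge> 2" "0 < v" "v \<le> 1"
  shows "(2 * sqrt v) powr \<alpha> + tail_const \<alpha> * abs_tail \<alpha> m v \<le> 2 powr \<alpha> + tail_const \<alpha> * abs_tail \<alpha> m 1"
proof -
  let ?F = "\<lambda>v. (2 * sqrt v) powr \<alpha> + tail_const \<alpha> * abs_tail \<alpha> m v"
  have "?F v \<le> ?F 1"
  proof (rule DERIV_nonneg_imp_nondecreasing[where f = ?F])
    fix u assume "v \<le> u"
    hence u: "0 < u" using assms by simp
    have "((\<lambda>v. (2 * sqrt v) powr \<alpha>) has_real_derivative \<alpha> * ((2 * sqrt u) powr \<alpha> / (2 * u))) (at u)"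
      using u by (auto intro!: derivative_eq_intros simp: powr_diff field_simps)
    hence d: "(?F has_real_derivative \<alpha> * ((2 * sqrt u) powr \<alpha> / (2 * u))
        + tail_const \<alpha> * (- abs_tail_deriv \<alpha> m u)) (at u)"
      by (intro DERIV_add DERIV_cmult has_real_derivative_abs_tail assms u)
    have "tail_const \<alpha> * abs_tail_deriv \<alpha> m u \<le> tail_const \<alpha> * ((2 * sqrt u) powr \<alpha> / (2 * u))"
      using tail_const_pos[OF assms(1,2)] abs_tail_deriv_le[OF assms(1-3) u]
      by (intro mult_left_mono) auto
    also have "\<dots> \<le> \<alpha> * ((2 * sqrt u) powr \<alpha> / (2 * u))"
      using tail_const_le[OF assms(1,2)] u by (intro mult_right_mono) auto
    finally have "0 \<le> \<alpha> * ((2 * sqrt u) powr \<alpha> / (2 * u)) + tail_const \<alpha> * (- abs_tail_deriv \<alpha> m u)"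
      by simp
    with d show "\<exists>y. (?F has_real_derivative y) (at u) \<and> 0 \<le> y"
      by blast
  qed (use assms in auto)
  thus ?thesis by simp
qed

section \<open>Comparison on the unit circle\<close>

lemma norm_tail_integral_le:
  fixes x :: complex
  assumes "0 < \<alpha>" "\<alpha> < 1" "m \<ge> 2" "norm x = 1" "x \<noteq> -1"
  shows "norm (tail_integral \<alpha> m x) \<le> abs_tail \<alpha> m ((1 + Re x) / 2)"
proof -
  \<comment> \<open>This makes v positive, so the kernel has no zero on [0, 1].\<close>
  have "- 1 < Re x"
  proof (rule ccontr)
    assume "\<not> - 1 < Re x"
    with abs_Re_le_cmod[of x] assms have "Re x = -1" by simp
    moreover from this assms have "Im x = 0" by (simp add: cmod_def)
    ultimately show False using assms by (simp add: complex_eq_iff)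
  qed
  thus ?thesis
    unfolding tail_integral_def abs_tail_def using assms
    by (intro integral_norm_bound_integral integrable_abs_tail
              integrable_continuous_interval[OF continuous_on_tail_integrand])
       (auto simp: norm_divide norm_one_plus_tx)
qed

text \<open>The equality case: at v = 1 the kernel is the square (1 + t)^2, so passing to norms
  loses nothing.\<close>

lemma tail_integral_1:
  assumes "0 < \<alpha>" "\<alpha> < 1" "m \<ge> 2"
  shows "tail_integral \<alpha> m 1 = of_real (abs_tail \<alpha> m 1)"
proof -
  have "((\<lambda>t. tail_weight \<alpha> m t / sqrt (kern 1 t)) has_integral abs_tail \<alpha> m 1) {0..1}"
    unfolding abs_tail_def using assms by (intro integrable_integral integrable_abs_tail) auto
  hence "((\<lambda>t. complex_of_real (tail_weight \<alpha> m t / sqrt (kern 1 t))) has_integral of_real (abs_tail \<alpha> m 1)) {0..1}"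
    by (rule has_integral_of_real)
  moreover have "sqrt (kern 1 t) = 1 + t" if "t \<in> {0..1}" for t
  proof -
    have "kern 1 t = (1 + t)\<^sup>2" unfolding kern_def by algebra
    thus ?thesis using that by simp
  qed
  ultimately have "((\<lambda>t. of_real (tail_weight \<alpha> m t) / (1 + of_real t * 1)) has_integral complex_of_real (abs_tail \<alpha> m 1)) {0..1}"
    by (subst has_integral_cong) auto
  thus ?thesis unfolding tail_integral_def by (rule integral_unique)
qed

text \<open>For n >= 1 the truncated subtraction is exact, and the last index 2 n - 1 leaves a
  remainder of even order 2 n.\<close>

lemma A_coeff_odd:
  assumes "n \<ge> 1"
  shows "A_coeff (2 * n - 1) \<alpha> x = (\<Sum>k<2 * n. (complex_of_real \<alpha> gchoose k) * x ^ k)"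
proof -
  have "{..2 * n - 1} = {..<2 * n}" using assms by auto
  thus ?thesis by (simp add: A_coeff_eq_sum)
qed

theorem corollary2:
  fixes \<alpha> :: real and n :: nat and x :: complex
  assumes "0 < \<alpha>" and "\<alpha> < 1" and "n \<ge> 1" and "norm x = 1"
  shows "Re (A_coeff (2 * n - 1) \<alpha> 1) \<ge> norm (A_coeff (2 * n - 1) \<alpha> x)"
proof -
  have n2: "2 * n \<ge> 2" using assms by simp
  have rhs: "Re (A_coeff (2 * n - 1) \<alpha> 1) = 2 powr \<alpha> + tail_const \<alpha> * abs_tail \<alpha> (2 * n) 1"
  proof -
    \<comment> \<open>The even order gives (-1)^(2 n) = 1, so at x = 1 the tail adds to 2^\<alpha>
      with a positive sign.\<close>
    have "A_coeff (2 * n - 1) \<alpha> 1 = of_real (2 powr \<alpha>) + of_real (tail_const \<alpha> * abs_tail \<alpha> (2 * n) 1)"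
      unfolding A_coeff_odd[OF assms(3)]
      using binomial_partial_sum[of \<alpha> "2 * n" 1] assms n2
      by (simp add: tail_integral_1 flip: powr_of_real)
    thus ?thesis by (simp flip: of_real_add)
  qed
  have main: "norm (A_coeff (2 * n - 1) \<alpha> y) \<le> Re (A_coeff (2 * n - 1) \<alpha> 1)"
    if y: "norm y = 1" "y \<noteq> -1" for y
  proof -
    define v where "v = (1 + Re y) / 2"
    have v1: "v \<le> 1" using abs_Re_le_cmod[of y] y by (simp add: v_def)
    have ny: "norm (1 + y) = 2 * sqrt v"
      using norm_one_plus_tx[OF y(1), of 1, folded v_def] by (simp add: kern_def real_sqrt_mult)
    have "1 + y \<noteq> 0" using y by (simp add: add_eq_0_iff)
    hence v0: "0 < v" using ny by (simp flip: zero_less_norm_iff)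
    have "norm (A_coeff (2 * n - 1) \<alpha> y)
        = norm ((1 + y) powr \<alpha> + tail_const \<alpha> * (- y) ^ (2 * n) * tail_integral \<alpha> (2 * n) y)"
      unfolding A_coeff_odd[OF assms(3)] using assms n2 y by (simp add: binomial_partial_sum)
    also have "\<dots> \<le> norm ((1 + y) powr \<alpha>) + norm (tail_const \<alpha> * (- y) ^ (2 * n) * tail_integral \<alpha> (2 * n) y)"
      by (rule norm_triangle_ineq)
    also have "\<dots> = (2 * sqrt v) powr \<alpha> + tail_const \<alpha> * norm (tail_integral \<alpha> (2 * n) y)"
      using tail_const_pos[OF assms(1,2)] y
      by (simp add: norm_powr_real_powr' ny norm_mult norm_power)
    also have "\<dots> \<le> (2 * sqrt v) powr \<alpha> + tail_const \<alpha> * abs_tail \<alpha> (2 * n) v"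
      using tail_const_pos[OF assms(1,2)] norm_tail_integral_le[OF assms(1,2) n2 y]
      by (simp add: v_def)
    also have "\<dots> \<le> Re (A_coeff (2 * n - 1) \<alpha> 1)"
      unfolding rhs by (intro powr_plus_abs_tail_le assms n2 v0 v1)
    finally show ?thesis .
  qed
  show ?thesis
  proof (cases "x = -1")
    case False
    thus ?thesis using main assms by simp
  next
    case True
    \<comment> \<open>The coefficient is a polynomial in x, so the bound extends to -1 = cis(pi) by
      continuity along the upper half circle.\<close>
    have "norm (A_coeff (2 * n - 1) \<alpha> (cis pi)) \<le> Re (A_coeff (2 * n - 1) \<alpha> 1)"
    proof (rule continuous_le_on_closure[where S = "{0..<pi}" and f = "\<lambda>\<theta>. norm (A_coeff (2 * n - 1) \<alpha> (cis \<theta>))"])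
      show "continuous_on (closure {0..<pi}) (\<lambda>\<theta>. norm (A_coeff (2 * n - 1) \<alpha> (cis \<theta>)))"
        unfolding A_coeff_eq_sum by (intro continuous_intros)
      fix \<theta> assume "\<theta> \<in> {0..<pi}"
      hence "cos pi < cos \<theta>" by (intro cos_monotone_0_pi) auto
      hence "cis \<theta> \<noteq> -1" by (auto simp: complex_eq_iff)
      thus "norm (A_coeff (2 * n - 1) \<alpha> (cis \<theta>)) \<le> Re (A_coeff (2 * n - 1) \<alpha> 1)"
        by (intro main norm_cis)
    next
      show "pi \<in> closure {0..<pi}" by simp
    qed
    thus ?thesis using True by simp
  qed
qed

end
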